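(* Every non-trivial, semi-transitive, additive, upper mixture-continuous and upper Archimedean binary relation $\succcurlyeq$ on a real vector space $X$ is complete and transitive.
   Context: $x\succ y$ iff $x\succcurlyeq y$ and not $y\succcurlyeq x$; $x\sim y$ iff $x\succcurlyeq y$ and $y\succcurlyeq x$. For $\lambda\in[0,1]$, $x\lambda y=\lambda x+(1-\lambda)y$. Non-trivial: there exist $x,y\in X$ with $x\succ y$. Semi-transitive: for all $x,y,z\in X$, $x\succ y\sim z$ implies $x\succ z$, and $x\sim y\succ z$ implies $x\succ z$. Additive: for all $x,y,z\in X$, $x\succcurlyeq y$ if and only if $x+z\succcurlyeq y+z$. Upper mixture-continuous: for all $x,y,z\in X$ the set $\{\lambda\in[0,1]:x\lambda y\succcurlyeq z\}$ is closed. Upper Archimedean: for all $x,y,z\in X$ with $x\succ y$ there exists $\lambda\in(0,1)$ with $x\lambda z\succ y$. Complete: $x\succcurlyeq y$ or $y\succcurlyeq x$ for all $x,y\in X$. *)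

theory Defs
  imports Complex_Main
begin

type_synonym 'a binrel = "'a \<Rightarrow> 'a \<Rightarrow> bool"

definition strict_part :: "'a binrel \<Rightarrow> 'a binrel" where
  "strict_part R x y \<longleftrightarrow> R x y \<and> \<not> R y x"

definition indiff_part :: "'a binrel \<Rightarrow> 'a binrel" where
  "indiff_part R x y \<longleftrightarrow> R x y \<and> R y x"

definition mixture :: "'a::real_vector \<Rightarrow> real \<Rightarrow> 'a \<Rightarrow> 'a" where
  "mixture x \<alpha> y = \<alpha> *\<^sub>R x + (1 - \<alpha>) *\<^sub>R y"

definition nontrivial :: "'a binrel \<Rightarrow> bool" where
  "nontrivial R \<longleftrightarrow> (\<exists>x y. strict_part R x y)"

definition semi_transitive :: "'a binrel \<Rightarrow> bool" where
  "semi_transitive R \<longleftrightarrow>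
     (\<forall>x y z. (strict_part R x y \<and> indiff_part R y z \<longrightarrow> strict_part R x z) \<and>
              (indiff_part R x y \<and> strict_part R y z \<longrightarrow> strict_part R x z))"

definition additive_rel :: "'a::real_vector binrel \<Rightarrow> bool" where
  "additive_rel R \<longleftrightarrow> (\<forall>x y z. R x y \<longleftrightarrow> R (x + z) (y + z))"

(* Since {0..1} is closed in the reals, closedness relative to {0..1} and closedness in the
   reals agree for these sets. *)
definition upper_mixture_continuous :: "'a::real_vector binrel \<Rightarrow> bool" where
  "upper_mixture_continuous R \<longleftrightarrow>
     (\<forall>x y z. closed {\<alpha> \<in> {0..1}. R (mixture x \<alpha> y) z})"

definition upper_archimedean :: "'a::real_vector binrel \<Rightarrow> bool" where
  "upper_archimedean R \<longleftrightarrow>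
     (\<forall>x y z. strict_part R x y \<longrightarrow> (\<exists>\<alpha>\<in>{0<..<1}. strict_part R (mixture x \<alpha> z) y))"

(* Unlike totalp, this includes the case x = y, so it entails reflexivity. *)
definition complete_rel :: "'a binrel \<Rightarrow> bool" where
  "complete_rel R \<longleftrightarrow> (\<forall>x y. R x y \<or> R y x)"

end

theory Submission imports Defs "HOL-Analysis.Elementary_Metric_Spaces" begin

text \<open>
  By additivity the relation is determined by \<open>P = {x. x \<succeq> 0}\<close>, with strict part \<open>S = P - (-P)\<close>
  and indifferent part \<open>I = P \<inter> -P\<close>; semi-transitivity says \<open>S + I \<subseteq> S\<close>. Walk from \<open>s \<in> S\<close>
  in direction \<open>d\<close> towards a point outside \<open>S\<close>, and let \<open>s + m d\<close> be the last accumulation point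
  of \<open>S\<close>. It lies in \<open>P\<close> by continuity and outside \<open>S\<close> by the Archimedean property, hence in \<open>I\<close>;
  subtracting it from nearby points of \<open>S\<close> yields arbitrarily small \<open>\<delta> > 0\<close> with \<open>-\<delta> d \<in> S\<close>.
  Applied within a line, this shows that \<open>S\<close> is a cone. Applied to \<open>d = z - s\<close>, it then gives
  \<open>s - z \<in> S\<close> whenever \<open>s \<in> S\<close> and \<open>z \<notin> P\<close>. Shrinking \<open>s\<close> to \<open>0\<close> gives completeness, and
  \<open>z = -y\<close> gives \<open>S + S \<subseteq> S\<close>, whence transitivity.
\<close>

locale upper_set =
  fixes P S :: "'a::real_vector set"
  assumes S_def: "S = {x \<in> P. - x \<notin> P}"
    and strict_add: "x \<in> S \<Longrightarrow> y \<in> P \<Longrightarrow> - y \<in> P \<Longrightarrow> x + y \<in> S"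
    and closed_segment_part: "closed {t \<in> {0..1}. x + t *\<^sub>R d \<in> P}"
    and archimedean: "x \<in> S \<Longrightarrow> \<exists>t\<in>{0<..<1}. x + t *\<^sub>R d \<in> S"
begin

lemma exit_point:
  assumes s: "s \<in> S" and out: "s + d \<notin> S"
  obtains m where "0 < m" "m \<le> 1" "s + m *\<^sub>R d \<in> P" "- (s + m *\<^sub>R d) \<in> P"
    "\<And>u. m < u \<Longrightarrow> u \<le> 1 \<Longrightarrow> s + u *\<^sub>R d \<notin> S"
    "\<And>e. 0 < e \<Longrightarrow> \<exists>\<delta>>0. \<delta> < e \<and> - (\<delta> *\<^sub>R d) \<in> S"
proof -
  define T where "T = {t \<in> {0..1}. s + t *\<^sub>R d \<in> S}"
  define m where "m = Sup T"
  have ne: "T \<noteq> {}" using s by (auto simp: T_def intro!: exI[of _ 0])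
  have bdd: "bdd_above T" by (auto simp: T_def intro: bdd_aboveI[of _ 1])
  have upper: "t \<le> m" if "t \<in> T" for t
    using that bdd by (simp add: m_def cSup_upper)
  have "m \<in> closure T" using ne bdd by (simp add: m_def closure_contains_Sup)
  moreover have "closure T \<subseteq> {t \<in> {0..1}. s + t *\<^sub>R d \<in> P}"
    by (rule closure_minimal) (use closed_segment_part in \<open>auto simp: T_def S_def\<close>)
  ultimately have m: "0 \<le> m" "m \<le> 1" "s + m *\<^sub>R d \<in> P" by auto
  have notS: "s + m *\<^sub>R d \<notin> S"
  proof
    assume inS: "s + m *\<^sub>R d \<in> S"
    then have "m < 1" using out m by (cases "m = 1") auto
    \<comment> \<open>Scaling the direction by \<open>1 - m\<close> keeps the Archimedean step past
      \<open>m\<close> at a parameter of at most 1, against maximality.\<close>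
    obtain t where t: "0 < t" "t < 1" "s + m *\<^sub>R d + t *\<^sub>R ((1 - m) *\<^sub>R d) \<in> S"
      using archimedean[OF inS] by fastforce
    have "t * (1 - m) \<le> 1 - m" using t m by (simp add: mult_left_le_one_le)
    moreover have "0 \<le> t * (1 - m)" using t m by simp
    moreover have "s + (m + t * (1 - m)) *\<^sub>R d \<in> S" using t(3) by (simp add: algebra_simps)
    ultimately have "m + t * (1 - m) \<in> T" using m by (simp add: T_def)
    with upper have "t * (1 - m) \<le> 0" by fastforce
    with t \<open>m < 1\<close> show False by (simp add: mult_le_0_iff)
  qed
  have neg: "- (s + m *\<^sub>R d) \<in> P" using m notS by (auto simp: S_def)
  have "m \<noteq> 0" using notS s by auto
  with m have "0 < m" by simp
  moreover have "s + u *\<^sub>R d \<notin> S" if "m < u" "u \<le> 1" for u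
    using that upper[of u] m by (auto simp: T_def)
  moreover have "\<exists>\<delta>>0. \<delta> < e \<and> - (\<delta> *\<^sub>R d) \<in> S" if e: "0 < e" for e
  proof -
    obtain u where u: "u \<in> T" "m - e < u"
      using less_cSup_iff[OF ne bdd, of "m - e"] e by (auto simp: m_def)
    \<comment> \<open>As \<open>m\<close> is not in \<open>T\<close>, the approximation is strict
      and \<open>m - u\<close> can serve as \<open>\<delta>\<close>.\<close>
    have "u \<noteq> m" using u notS by (auto simp: T_def)
    with upper[OF u(1)] have "u < m" by simp
    have "(s + u *\<^sub>R d) + - (s + m *\<^sub>R d) \<in> S"
    proof (rule strict_add)
      show "s + u *\<^sub>R d \<in> S" using u by (simp add: T_def)
      show "- (- (s + m *\<^sub>R d)) \<in> P" using m by (simp only: minus_minus)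
    qed (rule neg)
    moreover have "(s + u *\<^sub>R d) + - (s + m *\<^sub>R d) = - ((m - u) *\<^sub>R d)"
      by (simp add: algebra_simps)
    ultimately show ?thesis using u \<open>u < m\<close> by (intro exI[of _ "m - u"]) simp
  qed
  ultimately show ?thesis using that m neg by blast
qed

text \<open>The walk goes from \<open>s\<close> to 0, which is never strict, so its direction is
  \<open>- s\<close>.\<close>

lemma small_multiple:
  assumes "s \<in> S" "0 < e"
  obtains t where "0 < t" "t < e" "t *\<^sub>R s \<in> S"
proof -
  have "s + - s \<notin> S" by (simp add: S_def)
  from exit_point[OF assms(1) this] obtain t where "0 < t" "t < e" "- (t *\<^sub>R (- s)) \<in> S"
    using assms(2) by metis
  with that show ?thesis by simp
qed

text \<open>Otherwise, walking from a smaller strict multiple towards \<open>v *\<^sub>R s\<close>,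
  the exit point is indifferent and differs from the endpoint; adding a small strict multiple of
  \<open>s\<close> to it gives a point of \<open>S\<close> beyond the exit.\<close>

lemma weak_scale:
  assumes s: "s \<in> S" and v: "0 < v"
  shows "v *\<^sub>R s \<in> P"
proof (rule ccontr)
  assume out: "v *\<^sub>R s \<notin> P"
  obtain t where t: "0 < t" "t < v" "t *\<^sub>R s \<in> S" using small_multiple[OF s v] .
  have eq: "t *\<^sub>R s + (v - t) *\<^sub>R s = v *\<^sub>R s" by (simp add: algebra_simps)
  then have "t *\<^sub>R s + (v - t) *\<^sub>R s \<notin> S" using out by (simp add: S_def)
  from exit_point[OF t(3) this] obtain m where m: "m \<le> 1"
    "t *\<^sub>R s + m *\<^sub>R ((v - t) *\<^sub>R s) \<in> P" "- (t *\<^sub>R s + m *\<^sub>R ((v - t) *\<^sub>R s)) \<in> P"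
    and last: "\<And>u. m < u \<Longrightarrow> u \<le> 1 \<Longrightarrow> t *\<^sub>R s + u *\<^sub>R ((v - t) *\<^sub>R s) \<notin> S"
    by metis
  have "m \<noteq> 1" using m(2) out eq by auto
  with m t have "0 < (1 - m) * (v - t)" by simp
  \<comment> \<open>The bound on \<open>r\<close> keeps the new parameter
    \<open>m + r / (v - t)\<close> within 1.\<close>
  then obtain r where r: "0 < r" "r < (1 - m) * (v - t)" "r *\<^sub>R s \<in> S"
    using small_multiple[OF s] by blast
  have "r *\<^sub>R s + (t *\<^sub>R s + m *\<^sub>R ((v - t) *\<^sub>R s)) \<in> S" by (rule strict_add[OF r(3) m(2,3)])
  moreover have "r *\<^sub>R s + (t *\<^sub>R s + m *\<^sub>R ((v - t) *\<^sub>R s))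
      = t *\<^sub>R s + (m + r / (v - t)) *\<^sub>R ((v - t) *\<^sub>R s)"
  proof -
    have "(m + r / (v - t)) * (v - t) = m * (v - t) + r" using t by (simp add: field_simps)
    then show ?thesis by (simp add: scaleR_left_distrib)
  qed
  moreover have "m + r / (v - t) \<le> 1" "m < m + r / (v - t)"
    using r t by (auto simp: field_simps)
  ultimately show False using last by metis
qed

text \<open>An exit on the way to \<open>v *\<^sub>R s\<close> would make a positive multiple of
  \<open>- s\<close> strict, and \<open>weak_scale\<close> would put \<open>- s\<close> into
  \<open>P\<close>.\<close>

lemma strict_scale:
  assumes s: "s \<in> S" and v: "0 < v"
  shows "v *\<^sub>R s \<in> S"
proof (rule ccontr)
  assume out: "v *\<^sub>R s \<notin> S"
  obtain t where t: "0 < t" "t < v" "t *\<^sub>R s \<in> S" using small_multiple[OF s v] .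
  have "t *\<^sub>R s + (v - t) *\<^sub>R s \<notin> S" using out by (simp add: algebra_simps)
  from exit_point[OF t(3) this] obtain \<delta> where \<delta>: "0 < \<delta>" "- (\<delta> *\<^sub>R ((v - t) *\<^sub>R s)) \<in> S"
    by (metis zero_less_one)
  have "(1 / (\<delta> * (v - t))) *\<^sub>R (- (\<delta> *\<^sub>R ((v - t) *\<^sub>R s))) \<in> P"
    using \<delta> t by (intro weak_scale) auto
  then have "- s \<in> P" using \<delta> t by simp
  with s show False by (simp add: S_def)
qed

lemma strict_diff:
  assumes s: "s \<in> S" and z: "z \<notin> P"
  shows "s - z \<in> S"
proof -
  have "s + (z - s) \<notin> S" using z by (simp add: S_def)
  from exit_point[OF s this] obtain \<delta> where \<delta>: "0 < \<delta>" "- (\<delta> *\<^sub>R (z - s)) \<in> S"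
    by (metis zero_less_one)
  from strict_scale[OF \<delta>(2), of "1 / \<delta>"] \<delta>(1) show ?thesis by simp
qed

lemma total:
  assumes s: "s \<in> S"
  shows "z \<in> P \<or> - z \<in> P"
proof (rule disjCI)
  assume "- z \<notin> P"
  then have "t *\<^sub>R s - (- z) \<in> S" if "0 < t" for t
    using strict_diff strict_scale[OF s that] by blast
  then have "{0<..<1} \<subseteq> {t \<in> {0..1}. z + t *\<^sub>R s \<in> P}"
    by (auto simp: S_def algebra_simps)
  \<comment> \<open>The closure of the open interval contains 0, where the point is \<open>z\<close>
    itself.\<close>
  from closure_minimal[OF this closed_segment_part] show "z \<in> P"
    by (auto simp: subset_iff)
qed

text \<open>If \<open>x + y\<close> is outside \<open>P\<close>, its negative is strict by totality.
  An indifferent summand added to that negative would make the negative of the other summand strict;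
  if neither is indifferent, \<open>strict_diff\<close> with \<open>z = - y\<close> makes
  \<open>x + y\<close> strict.\<close>

lemma add_closed:
  assumes x: "x \<in> P" and y: "y \<in> P" and ne: "S \<noteq> {}"
  shows "x + y \<in> P"
proof (rule ccontr)
  assume out: "x + y \<notin> P"
  moreover have "- (x + y) \<in> P" using total[of _ "x + y"] ne out by blast
  ultimately have w: "- (x + y) \<in> S" by (simp add: S_def add.commute)
  have "- y \<in> P" if "- x \<in> P"
    using out strict_add[OF w x that] y by (simp add: S_def)
  moreover have "- x \<in> P" if "- y \<in> P"
    using out strict_add[OF w y that] x by (simp add: S_def)
  moreover have "- x \<in> P" if "- y \<notin> P"
  proof (rule ccontr)
    assume "- x \<notin> P"
    with x have "x \<in> S" by (simp add: S_def)
    from strict_diff[OF this that] out show False by (simp add: S_def)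
  qed
  ultimately have "- x \<in> P" "- y \<in> P" by blast+
  with strict_add[OF w x] y show False by (simp add: S_def)
qed

end

theorem proposition9:
  fixes R :: "'a::real_vector \<Rightarrow> 'a \<Rightarrow> bool"
  assumes "nontrivial R"
    and "semi_transitive R"
    and "additive_rel R"
    and "upper_mixture_continuous R"
    and "upper_archimedean R"
  shows "complete_rel R \<and> transp R"
proof -
  define P where "P = {x. R x 0}"
  define S where "S = {x \<in> P. - x \<notin> P}"
  have add: "R (x + z) (y + z) \<longleftrightarrow> R x y" for x y z
    using assms(3) by (simp add: additive_rel_def)
  have R_iff: "R x y \<longleftrightarrow> x - y \<in> P" for x y
    using add[of x "- y" y] by (simp add: P_def)
  have strict_iff: "strict_part R x y \<longleftrightarrow> x - y \<in> S" for x y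
    by (simp add: strict_part_def R_iff S_def)
  have mix: "mixture (x + d) t x = x + t *\<^sub>R d" for x d :: 'a and t
    by (simp add: mixture_def algebra_simps)
  interpret upper_set P S
  proof (unfold_locales)
    show "S = {x \<in> P. - x \<notin> P}" by (simp add: S_def)
  next
    fix x y assume "x \<in> S" "y \<in> P" "- y \<in> P"
    then have "strict_part R x 0" "indiff_part R 0 (- y)"
      by (simp_all add: strict_iff indiff_part_def R_iff)
    with assms(2) have "strict_part R x (- y)" unfolding semi_transitive_def by blast
    then show "x + y \<in> S" by (simp add: strict_iff)
  next
    fix x d
    have "closed {t \<in> {0..1}. R (mixture (x + d) t x) 0}"
      using assms(4) unfolding upper_mixture_continuous_def by blast
    then show "closed {t \<in> {0..1}. x + t *\<^sub>R d \<in> P}" by (simp add: mix R_iff)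
  next
    fix x d assume "x \<in> S"
    then have "strict_part R x 0" by (simp add: strict_iff)
    with assms(5) obtain t where t: "t \<in> {0<..<1}" "strict_part R (mixture x t (x + d)) 0"
      unfolding upper_archimedean_def by blast
    \<comment> \<open>Here the weight \<open>t\<close> sits on \<open>x\<close>, so the position
      along \<open>d\<close> is \<open>1 - t\<close>.\<close>
    have "mixture x t (x + d) = x + (1 - t) *\<^sub>R d" by (simp add: mixture_def algebra_simps)
    with t show "\<exists>t\<in>{0<..<1}. x + t *\<^sub>R d \<in> S"
      by (intro bexI[of _ "1 - t"]) (auto simp: strict_iff)
  qed
  obtain s where s: "s \<in> S"
    using assms(1) by (auto simp: nontrivial_def strict_iff)
  have "complete_rel R"
    unfolding complete_rel_def R_iff using total[OF s] by (metis minus_diff_eq)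
  moreover have "transp R"
  proof (rule transpI)
    fix x y z assume "R x y" "R y z"
    then have "(x - y) + (y - z) \<in> P" using s by (intro add_closed) (auto simp: R_iff)
    then show "R x z" by (simp add: R_iff)
  qed
  ultimately show ?thesis ..
qed

end
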